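(* Let $d\ge2$ and $n\ge1$ and consider the $d$-armed adversarial bandit problem: an adversary fixes $z_1,\dots,z_n\in[0,1]^d$; in round $t$ the learner samples an action $A_t\in\{1,\dots,d\}$ from a distribution depending on past actions and observations, and observes $\sigma_t=z_{t,A_t}$. Let $\mathcal D=\{q\in[0,1]^d:\sum_{i=1}^dq_i=1\}$, $F(q)=-2\sum_{i=1}^d\sqrt{q_i}$ and $\eta=\sqrt{8/n}$. For $q\in\operatorname{relint}(\mathcal D)$, $a\in\{1,\dots,d\}$ and $\sigma\in[0,1]$ let $g_q(a,\sigma)\in\mathbb R^d$ be the vector with coordinates $$g_q(a,\sigma)_b=\mathbf 1_{a=b}\left(\sigma-\frac12+\frac\eta8\left(1+\frac1{q_b+\sqrt{q_b}}\right)\right)-\frac{q_a\eta}{8(q_b+\sqrt{q_b})},\qquad b=1,\dots,d.$$ Consider mirror descent that plays $A_t\sim Q_t$, where $Q_1=\arg\min_{q\in\mathcal D}F(q)$ and $$Q_{t+1}=\arg\min_{q\in\mathcal D}\ \langle q,\hat\ell_t\rangle+\frac1\eta\operatorname{D}(q,Q_t),\qquad \hat\ell_t=\frac{g_{Q_t}(A_t,\sigma_t)}{Q_{t,A_t}}.$$ Then for every $(z_t)_{t=1}^n$ the regret $\mathfrak R_n=\max_{a\in\{1,\dots,d\}}\mathbb E\left[\sum_{t=1}^n(z_{t,A_t}-z_{t,a})\right]$ satisfies $$\mathfrak R_n\le\sqrt{2dn}.$$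
   Context: $F$ is defined on the positive orthant by the given formula (extended by continuity to its closure, and $+\infty$ elsewhere), and $\operatorname{D}(p,q)=F(p)-F(q)-\langle\nabla F(q),p-q\rangle$ is its Bregman divergence. $\operatorname{relint}(\mathcal D)$ is the relative interior of the simplex, i.e. the probability vectors with all coordinates strictly positive. $Q_{t,a}$ denotes the $a$-th coordinate of $Q_t$. *)

theory Defs
  imports "HOL-Probability.Probability"
begin

section \<open>Adversarial bandits\<close>

text \<open>A learner maps the observed history, a list of pairs (action, observed loss) in
  chronological order, to the distribution of the next action. Losses are indexed by rounds
  \<open>1, 2, \<dots>\<close>, so the pair of round \<open>t\<close> is element \<open>t - 1\<close> of a history.\<close>

type_synonym 'd history = "('d \<times> real) list"
type_synonym 'd learner = "'d history \<Rightarrow> 'd pmf"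

primrec interaction :: "('d::finite) learner \<Rightarrow> (nat \<Rightarrow> real^'d) \<Rightarrow> nat \<Rightarrow> 'd history pmf" where
  "interaction \<pi> z 0 = return_pmf []"
| "interaction \<pi> z (Suc t) =
     bind_pmf (interaction \<pi> z t) (\<lambda>h. map_pmf (\<lambda>a. h @ [(a, z (Suc t) $ a)]) (\<pi> h))"

definition action :: "'d history \<Rightarrow> nat \<Rightarrow> 'd" where
  "action h t = fst (h ! (t - 1))"

definition regret :: "('d::finite) learner \<Rightarrow> (nat \<Rightarrow> real^'d) \<Rightarrow> nat \<Rightarrow> real" where
  "regret \<pi> z n =
     Max (range (\<lambda>a. measure_pmf.expectation (interaction \<pi> z n)
                       (\<lambda>h. \<Sum>t=1..n. z t $ action h t - z t $ a)))"

section \<open>Mirror descent\<close>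

definition prob_simplex :: "(real^'d) set" where
  "prob_simplex = {q. (\<forall>i. 0 \<le> q $ i \<and> q $ i \<le> 1) \<and> (\<Sum>i\<in>UNIV. q $ i) = 1}"

definition potential :: "real^'d \<Rightarrow> ereal" where
  "potential q = (if \<forall>i. 0 \<le> q $ i then ereal (- 2 * (\<Sum>i\<in>UNIV. sqrt (q $ i))) else \<infinity>)"

definition gradient :: "('a::real_inner \<Rightarrow> ereal) \<Rightarrow> 'a \<Rightarrow> 'a" where
  "gradient F q = (THE D. GDERIV (\<lambda>x. real_of_ereal (F x)) q :> D)"

definition bregman :: "('a::real_inner \<Rightarrow> ereal) \<Rightarrow> 'a \<Rightarrow> 'a \<Rightarrow> ereal" where
  "bregman F p q = F p - F q - ereal (gradient F q \<bullet> (p - q))"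

text \<open>Only meaningful for \<open>q\<close> in the relative interior of the simplex.\<close>

definition estimator :: "real \<Rightarrow> real^'d \<Rightarrow> 'd \<Rightarrow> real \<Rightarrow> real^'d" where
  "estimator \<eta> q a \<sigma> = (\<chi> b.
     of_bool (a = b) * (\<sigma> - 1 / 2 + \<eta> / 8 * (1 + 1 / (q $ b + sqrt (q $ b))))
     - q $ a * \<eta> / (8 * (q $ b + sqrt (q $ b))))"

definition md_start :: "real^'d" where
  "md_start = arg_min_on potential prob_simplex"

definition md_step :: "real \<Rightarrow> real^'d \<Rightarrow> 'd \<Rightarrow> real \<Rightarrow> real^'d" where
  "md_step \<eta> q a \<sigma> =
     (let l = (1 / q $ a) *\<^sub>R estimator \<eta> q a \<sigma>
      in arg_min_on (\<lambda>p. ereal (p \<bullet> l) + ereal (1 / \<eta>) * bregman potential p q) prob_simplex)"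

definition md_iterate :: "real \<Rightarrow> ('d::finite) history \<Rightarrow> real^'d" where
  "md_iterate \<eta> h = foldl (\<lambda>q (a, \<sigma>). md_step \<eta> q a \<sigma>) md_start h"

text \<open>\<open>potential\<close> is strictly convex and its gradient blows up at the boundary of the simplex, so for
  positive \<open>\<eta>\<close> every minimiser above exists, is unique and has strictly positive coordinates; hence
  \<open>embed_pmf\<close> is applied to a probability mass function.\<close>

definition mirror_descent :: "real \<Rightarrow> ('d::finite) learner" where
  "mirror_descent \<eta> h = embed_pmf (\<lambda>a. md_iterate \<eta> h $ a)"

end

theory Submission
  imports Defs
begin

text \<open>For this potential the Bregman divergence is
  \<open>D(p, q) = \<Sum>(\<surd>p\<^sub>b - \<surd>q\<^sub>b)\<^sup>2 / \<surd>q\<^sub>b\<close>, and one round of mirror descent costs at most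
  \<open>\<eta>\<inverse> \<Sum>\<^sub>b r\<^sub>b x\<^sub>b\<^sup>2 / (1 + x\<^sub>b)\<close> with \<open>r\<^sub>b = \<surd>q\<^sub>b\<close> and
  \<open>x\<^sub>b = \<eta> r\<^sub>b l\<^sub>b\<close>. Put \<open>c = \<eta>\<^sup>2 / 8 = 1 / n\<close>. The estimator is such that
  \<open>x\<^sub>b = (\<sigma> - 1/2) \<eta> / r\<^sub>b + c / r\<^sub>b\<^sup>2\<close> if \<open>b\<close> was played and
  \<open>x\<^sub>b = - c / (1 + r\<^sub>b)\<close> otherwise, so for \<open>c \<le> 1/2\<close> the conditional expectation of
  \<open>x\<^sub>b\<^sup>2 / (1 + x\<^sub>b)\<close> is at most \<open>c (2 + r\<^sub>b)\<close>. By Cauchy-Schwarz the expected cost of a round is at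
  most \<open>\<eta>\<inverse> c (2 \<surd>d + 1)\<close>. The \<open>n\<close> rounds together cost \<open>\<eta>\<inverse> (2 \<surd>d + 1)\<close>, and the initial divergence
  contributes \<open>\<eta>\<inverse> (2 \<surd>d - 2)\<close>; the sum is below \<open>4 \<surd>d / \<eta> = \<surd>(2 d n)\<close>. The remaining case
  \<open>n = 1\<close> is trivial.\<close>

section \<open>Closed form of the Bregman divergence\<close>

definition root_div :: "real^'d::finite \<Rightarrow> real^'d \<Rightarrow> real" where
  "root_div p q = (\<Sum>b\<in>UNIV. (sqrt (p $ b) - sqrt (q $ b))\<^sup>2 / sqrt (q $ b))"

lemma root_div_nonneg: "(\<And>b. 0 \<le> q $ b) \<Longrightarrow> 0 \<le> root_div p q"
  unfolding root_div_def by (intro sum_nonneg) auto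

lemma root_div_expand:
  assumes "\<And>b. 0 \<le> p $ b" "\<And>b. 0 < q $ b"
  shows "root_div p q = - 2 * (\<Sum>b\<in>UNIV. sqrt (p $ b)) + 2 * (\<Sum>b\<in>UNIV. sqrt (q $ b))
           + (\<Sum>b\<in>UNIV. (p $ b - q $ b) / sqrt (q $ b))"
proof -
  have *: "(sqrt (p $ b) - sqrt (q $ b))\<^sup>2 / sqrt (q $ b)
      = - 2 * sqrt (p $ b) + 2 * sqrt (q $ b) + (p $ b - q $ b) / sqrt (q $ b)" for b
    using assms(1)[of b] assms(2)[of b]
    by (simp add: field_simps power2_diff)
  show ?thesis
    unfolding root_div_def by (simp only: * sum.distrib sum_distrib_left)
qed

lemma gradient_potential:
  fixes q :: "real^'d::finite"
  assumes "\<And>b. 0 < q $ b"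
  shows "gradient potential q = (\<chi> b. - 1 / sqrt (q $ b))"
proof -
  let ?D = "(\<chi> b. - 1 / sqrt (q $ b)) :: real^'d"
  let ?f = "\<lambda>x::real^'d. - 2 * (\<Sum>b\<in>UNIV. sqrt (x $ b))"
  have *: "(?f has_derivative (\<lambda>h. h \<bullet> ?D)) (at q)"
  proof -
    have c: "((\<lambda>x::real^'d. sqrt (x $ b)) has_derivative (\<lambda>h. h $ b / sqrt (q $ b) / 2)) (at q)" for b
      using assms[of b]
      by (auto intro!: derivative_eq_intros bounded_linear.has_derivative[OF bounded_linear_vec_nth]
          simp: field_simps)
    have "(?f has_derivative (\<lambda>h. - 2 * (\<Sum>b\<in>UNIV. h $ b / sqrt (q $ b) / 2))) (at q)"
      by (intro has_derivative_mult_right has_derivative_sum c)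
    then show ?thesis
      by (simp add: inner_vec_def sum_distrib_left sum_negf)
  qed
  \<comment> \<open>The square-root formula for \<open>potential\<close> holds only on the orthant,
    so the derivative is transferred along an open neighbourhood of \<open>q\<close>.\<close>
  have "open {x::real^'d. \<forall>b. 0 < x $ b}"
    unfolding Collect_all_eq by (intro open_INT ballI open_Collect_less continuous_intros) auto
  then have ev: "eventually (\<lambda>x. \<forall>b. 0 < x $ b) (nhds q)"
    using assms by (auto simp: eventually_nhds)
  have "((\<lambda>x. real_of_ereal (potential x)) has_derivative (\<lambda>h. h \<bullet> ?D)) (at q)"
  proof (rule has_derivative_transform_eventually[OF *])
    show "\<forall>\<^sub>F x in at q. ?f x = real_of_ereal (potential x)"
      using eventually_nhds_conv_at[THEN iffD1, OF ev, THEN conjunct1] by eventually_elim (auto simp: potential_def less_imp_le)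
    show "?f q = real_of_ereal (potential q)"
      using assms by (auto simp: potential_def less_imp_le)
  qed auto
  then have "GDERIV (\<lambda>x. real_of_ereal (potential x)) q :> ?D"
    by (simp add: gderiv_def)
  \<comment> \<open>\<open>gradient\<close> is a definite description, so uniqueness is required as
    well.\<close>
  moreover have "E = ?D" if "GDERIV (\<lambda>x. real_of_ereal (potential x)) q :> E" for E
    using that calculation by (metis gderiv_def has_derivative_unique vector_eq_ldot inner_commute)
  ultimately show ?thesis
    unfolding gradient_def by (rule the_equality)
qed

lemma bregman_potential:
  assumes "\<And>b. 0 \<le> p $ b" "\<And>b. 0 < q $ b"
  shows "bregman potential p q = ereal (root_div p q)"
proof -
  have "\<forall>b. 0 \<le> q $ b" using assms(2) less_imp_le by blast
  moreover have "gradient potential q \<bullet> (p - q) = - (\<Sum>b\<in>UNIV. (p $ b - q $ b) / sqrt (q $ b))"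
    by (simp add: gradient_potential[OF assms(2)] inner_vec_def sum_negf)
  ultimately show ?thesis
    using assms(1) root_div_expand[OF assms] by (simp add: bregman_def potential_def)
qed

section \<open>Minimisers over the simplex and the mirror step\<close>

definition interior_simplex :: "(real^'d::finite) set" where
  "interior_simplex = {q. (\<forall>b. 0 < q $ b) \<and> (\<Sum>b\<in>UNIV. q $ b) = 1}"

lemma interior_simplexD:
  assumes "q \<in> interior_simplex"
  shows "0 < q $ b" "(\<Sum>b\<in>UNIV. q $ b) = 1"
  using assms by (auto simp: interior_simplex_def)

lemma interior_simplex_subset: "interior_simplex \<subseteq> prob_simplex"
proof
  fix q :: "real^'d" assume q: "q \<in> interior_simplex"
  have "q $ b \<le> 1" for b
    using member_le_sum[of b UNIV "($) q"] interior_simplexD[OF q] by (simp add: less_imp_le)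
  then show "q \<in> prob_simplex"
    using interior_simplexD[OF q] by (auto simp: prob_simplex_def less_imp_le)
qed

text \<open>The minimiser is \<open>p\<^sub>b = (v\<^sub>b + \<lambda>)\<^sup>-\<^sup>2\<close>, with the multiplier \<open>\<lambda>\<close> fixed by \<open>\<Sum>p\<^sub>b = 1\<close>.\<close>

lemma linear_root_minimiser:
  fixes v :: "real^'d::finite"
  obtains p where "p \<in> interior_simplex"
    and "\<And>u. u \<in> prob_simplex \<Longrightarrow>
       u \<bullet> v - 2 * (\<Sum>b\<in>UNIV. sqrt (u $ b)) = p \<bullet> v - 2 * (\<Sum>b\<in>UNIV. sqrt (p $ b)) + root_div u p"
proof -
  \<comment> \<open>Subtracting the least coordinate keeps every \<open>v $ b - m + y\<close> at
    least \<open>y\<close>. The multiplier is \<open>y - m\<close>, with \<open>y\<close> sought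
    between 1 and the root of the dimension.\<close>
  define m where "m = Min (range (($) v))"
  define s where "s = (\<lambda>y. \<Sum>b\<in>UNIV. 1 / (v $ b - m + y)\<^sup>2)"
  have m: "m \<le> v $ b" for b by (simp add: m_def)
  have "m \<in> range (($) v)" unfolding m_def by (intro Min_in) auto
  then obtain b0 where b0: "v $ b0 = m" by auto
  let ?d = "sqrt (real CARD('d))"
  have d: "1 \<le> ?d" by (simp add: Suc_leI)
  \<comment> \<open>At this end each of the d terms is at most 1/d; at \<open>y = 1\<close> the
    coordinate attaining \<open>m\<close> alone contributes 1.\<close>
  have "s ?d \<le> (\<Sum>b\<in>(UNIV::'d set). 1 / ?d\<^sup>2)"
    unfolding s_def
  proof (intro sum_mono divide_left_mono power_mono mult_pos_pos zero_less_power)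
    show "0 < v $ b - m + ?d" "?d \<le> v $ b - m + ?d" for b using m[of b] d by linarith+
  qed (use d in auto)
  then have s1: "s ?d \<le> 1" by simp
  have "1 \<le> s 1"
    unfolding s_def using member_le_sum[of b0 UNIV "\<lambda>b. 1 / (v $ b - m + 1)\<^sup>2"] b0 by simp
  moreover have "continuous_on {1..?d} s"
  proof -
    have "v $ b - m + y \<noteq> 0" if "y \<in> {1..?d}" for b y
      using m[of b] that by auto
    then show ?thesis
      unfolding s_def by (intro continuous_intros) auto
  qed
  ultimately obtain y where y: "1 \<le> y" "s y = 1"
    using IVT2'[of s ?d 1 1] s1 d by auto
  define p where "p = (\<chi> b. 1 / (v $ b - m + y)\<^sup>2)"
  have pos: "0 < v $ b - m + y" for b using m[of b] y by simp
  have p: "p \<in> interior_simplex"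
    using y pos by (auto simp: interior_simplex_def p_def s_def less_imp_neq[symmetric])
  \<comment> \<open>The first-order condition. It turns the linear part of
    \<open>root_div_expand\<close> into a difference of inner products with \<open>v\<close>, plus a
    multiple of a difference of coordinate sums, which vanishes on the simplex. Hence the excess
    over the minimum is known exactly.\<close>
  have sq: "1 / sqrt (p $ b) = v $ b - m + y" for b
    using pos[of b] by (simp add: p_def real_sqrt_divide)
  have "u \<bullet> v - 2 * (\<Sum>b\<in>UNIV. sqrt (u $ b)) = p \<bullet> v - 2 * (\<Sum>b\<in>UNIV. sqrt (p $ b)) + root_div u p"
    if u: "u \<in> prob_simplex" for u
  proof -
    have "(\<Sum>b\<in>UNIV. (u $ b - p $ b) / sqrt (p $ b)) = (\<Sum>b\<in>UNIV. (u $ b - p $ b) * (v $ b - m + y))"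
      by (subst sq[symmetric]) simp
    also have "\<dots> = u \<bullet> v - p \<bullet> v + (y - m) * ((\<Sum>b\<in>UNIV. u $ b) - (\<Sum>b\<in>UNIV. p $ b))"
      by (simp add: inner_vec_def sum_subtractf[symmetric] sum.distrib[symmetric] sum_distrib_left)
         (simp add: algebra_simps)
    also have "\<dots> = u \<bullet> v - p \<bullet> v"
      using u interior_simplexD(2)[OF p] by (simp add: prob_simplex_def)
    finally show ?thesis
      using u interior_simplexD(1)[OF p] by (subst root_div_expand) (auto simp: prob_simplex_def)
  qed
  with p that show ?thesis by blast
qed

lemma root_div_eq_0:
  assumes "root_div u p = 0" "\<And>b. 0 < p $ b"
  shows "u = p"
proof -
  have "(sqrt (u $ b) - sqrt (p $ b))\<^sup>2 / sqrt (p $ b) = 0" for b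
    using assms sum_nonneg_eq_0_iff[of UNIV "\<lambda>b. (sqrt (u $ b) - sqrt (p $ b))\<^sup>2 / sqrt (p $ b)"]
    by (simp add: root_div_def less_imp_le)
  then show ?thesis
    using assms(2) by (simp add: vec_eq_iff) (metis less_irrefl)
qed

text \<open>\<open>arg_min_on\<close> is a choice operator, so it is pinned down only by uniqueness.
  An excess that is a positive multiple of \<open>root_div\<close> supplies it, since
  \<open>root_div\<close> vanishes only at its centre.\<close>

lemma arg_min_on_root_div:
  assumes p: "p \<in> interior_simplex" and "0 < k"
    and f: "\<And>u. u \<in> prob_simplex \<Longrightarrow> f u = ereal (C + k * root_div u p)"
  shows "arg_min_on f prob_simplex = p"
proof -
  have p': "p \<in> prob_simplex" using p interior_simplex_subset by blast
  have pos: "0 < p $ b" for b using interior_simplexD(1)[OF p] .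
  have fp: "f p = ereal C" using f[OF p'] by (simp add: root_div_def)
  have min: "is_arg_min f (\<lambda>x. x \<in> prob_simplex) p"
    using p' fp f root_div_nonneg[of p] pos \<open>0 < k\<close>
    by (auto simp: is_arg_min_linorder less_imp_le)
  have "u = p" if "is_arg_min f (\<lambda>x. x \<in> prob_simplex) u" for u
  proof -
    have u: "u \<in> prob_simplex" "f u \<le> f p" using that p' by (auto simp: is_arg_min_linorder)
    then have "k * root_div u p \<le> 0" using f[OF u(1)] fp by simp
    then have "root_div u p = 0"
      using root_div_nonneg[of p u] pos \<open>0 < k\<close> by (smt (verit) mult_pos_pos less_imp_le)
    then show ?thesis using root_div_eq_0 pos by blast
  qed
  with min show ?thesis
    unfolding arg_min_on_def arg_min_def by blast
qed

text \<open>On the simplex \<open>root_div u q\<close> is the potential plus the linear function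
  given by \<open>w\<close>, the negative gradient at \<open>q\<close>, up to a constant. So
  \<open>linear_root_minimiser\<close> applies with vector \<open>\<eta> *\<^sub>R l + w\<close>,
  and its exact excess makes the three-point relation an equation.\<close>

lemma mirror_step:
  fixes q l :: "real^'d::finite"
  assumes q: "q \<in> interior_simplex" and "0 < \<eta>"
  defines "p \<equiv> arg_min_on (\<lambda>p. ereal (p \<bullet> l) + ereal (1 / \<eta>) * bregman potential p q) prob_simplex"
  shows "p \<in> interior_simplex"
    and "u \<in> prob_simplex \<Longrightarrow> \<eta> * ((p - u) \<bullet> l) = root_div u q - root_div u p - root_div p q"
proof -
  define w :: "real^'d" where "w = (\<chi> b. 1 / sqrt (q $ b))"
  obtain p' where p': "p' \<in> interior_simplex"
    and id: "\<And>u. u \<in> prob_simplex \<Longrightarrow>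
       u \<bullet> (\<eta> *\<^sub>R l + w) - 2 * (\<Sum>b\<in>UNIV. sqrt (u $ b)) =
       p' \<bullet> (\<eta> *\<^sub>R l + w) - 2 * (\<Sum>b\<in>UNIV. sqrt (p' $ b)) + root_div u p'"
    using linear_root_minimiser[of "\<eta> *\<^sub>R l + w"] by blast
  have p'': "p' \<in> prob_simplex" using p' interior_simplex_subset by blast
  have div: "root_div u q = u \<bullet> w - 2 * (\<Sum>b\<in>UNIV. sqrt (u $ b)) - (q \<bullet> w - 2 * (\<Sum>b\<in>UNIV. sqrt (q $ b)))"
    if "u \<in> prob_simplex" for u
    using that interior_simplexD(1)[OF q]
    by (subst root_div_expand)
       (auto simp: prob_simplex_def w_def inner_vec_def diff_divide_distrib sum_subtractf)
  have three: "\<eta> * (u \<bullet> l) + root_div u q = \<eta> * (p' \<bullet> l) + root_div p' q + root_div u p'"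
    if "u \<in> prob_simplex" for u
    using id[OF that] div[OF that] div[OF p''] by (simp add: inner_add_right)
  have "p = p'"
    unfolding p_def
  proof (rule arg_min_on_root_div[OF p'])
    fix u :: "real^'d" assume u: "u \<in> prob_simplex"
    have "bregman potential u q = ereal (root_div u q)"
      using u interior_simplexD(1)[OF q] by (intro bregman_potential) (auto simp: prob_simplex_def)
    moreover have "u \<bullet> l + 1 / \<eta> * root_div u q
        = (p' \<bullet> l + 1 / \<eta> * root_div p' q) + 1 / \<eta> * root_div u p'"
      using three[OF u] \<open>0 < \<eta>\<close> by (simp add: field_simps)
    ultimately show "ereal (u \<bullet> l) + ereal (1 / \<eta>) * bregman potential u q
        = ereal (p' \<bullet> l + 1 / \<eta> * root_div p' q + 1 / \<eta> * root_div u p')" by simp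
  qed (use \<open>0 < \<eta>\<close> in simp)
  with p' show "p \<in> interior_simplex" by simp
  show "\<eta> * ((p - u) \<bullet> l) = root_div u q - root_div u p - root_div p q" if "u \<in> prob_simplex"
    using three[OF that] \<open>p = p'\<close> by (simp add: inner_diff_left algebra_simps)
qed

lemma axis_in_prob_simplex: "axis a 1 \<in> prob_simplex"
  by (auto simp: prob_simplex_def axis_def)

lemma sum_sqrt_le:
  fixes q :: "real^'d::finite"
  assumes "q \<in> prob_simplex"
  shows "(\<Sum>b\<in>UNIV. sqrt (q $ b)) \<le> sqrt (real CARD('d))"
proof -
  have "(\<Sum>b\<in>UNIV. 1 * sqrt (q $ b))\<^sup>2 \<le> (\<Sum>b\<in>(UNIV::'d set). 1\<^sup>2) * (\<Sum>b\<in>UNIV. (sqrt (q $ b))\<^sup>2)"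
    by (rule Cauchy_Schwarz_ineq_sum)
  then have "(\<Sum>b\<in>UNIV. sqrt (q $ b))\<^sup>2 \<le> real CARD('d)"
    using assms by (simp add: prob_simplex_def)
  then show ?thesis by (rule real_le_rsqrt)
qed

text \<open>With zero linear term the divergence to the start is a difference of potential values:
  -2 at a vertex, and at least -2 sqrt(d) on the simplex by Cauchy-Schwarz.\<close>

lemma md_start:
  "(md_start :: real^'d::finite) \<in> interior_simplex"
  "root_div (axis a 1) (md_start :: real^'d) \<le> 2 * sqrt (real CARD('d)) - 2"
proof -
  obtain p :: "real^'d" where p: "p \<in> interior_simplex"
    and id: "\<And>u. u \<in> prob_simplex \<Longrightarrow>
       - 2 * (\<Sum>b\<in>UNIV. sqrt (u $ b)) = - 2 * (\<Sum>b\<in>UNIV. sqrt (p $ b)) + root_div u p"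
    using linear_root_minimiser[of 0] by auto
  have "md_start = p"
    unfolding md_start_def
  proof (rule arg_min_on_root_div[OF p])
    show "potential u = ereal (- 2 * (\<Sum>b\<in>UNIV. sqrt (p $ b)) + 1 * root_div u p)"
      if "u \<in> prob_simplex" for u
      using that id[OF that] by (simp add: potential_def prob_simplex_def)
  qed simp
  moreover have "(\<Sum>b\<in>UNIV. sqrt (axis a (1::real) $ b)) = 1"
    by (simp add: axis_def if_distrib[of sqrt] cong: if_cong)
  ultimately show "(md_start :: real^'d) \<in> interior_simplex"
    "root_div (axis a 1) (md_start :: real^'d) \<le> 2 * sqrt (real CARD('d)) - 2"
    using p id[OF axis_in_prob_simplex, of a] sum_sqrt_le[of p] interior_simplex_subset by auto
qed

section \<open>Iterates as probability vectors\<close>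

lemma md_step_interior:
  assumes "q \<in> interior_simplex" "0 < \<eta>"
  shows "md_step \<eta> q a \<sigma> \<in> interior_simplex"
  unfolding md_step_def Let_def by (rule mirror_step(1)[OF assms])

lemma md_iterate_interior:
  assumes "0 < \<eta>"
  shows "md_iterate \<eta> h \<in> interior_simplex"
proof (induction h rule: rev_induct)
  case Nil
  then show ?case by (simp add: md_iterate_def md_start)
next
  case (snoc x h)
  then show ?case
    using md_step_interior[OF _ assms] by (cases x) (simp add: md_iterate_def)
qed

lemma pmf_mirror_descent:
  assumes "0 < \<eta>"
  shows "pmf (mirror_descent \<eta> h) a = md_iterate \<eta> h $ a"
  unfolding mirror_descent_def
  using interior_simplexD[OF md_iterate_interior[OF assms, of h]]
  by (intro pmf_embed_pmf) (auto simp: nn_integral_count_space_finite less_imp_le sum_ennreal)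

section \<open>Cost of a single round\<close>

text \<open>In each coordinate, with \<open>r\<close>, \<open>s\<close> the roots of
  \<open>q $ b\<close>, \<open>p $ b\<close> and \<open>x = r * l $ b\<close>, the left side is a
  quadratic in \<open>s\<close>, concave because \<open>1 + x > 0\<close>. Its maximum, at
  \<open>s = r / (1 + x)\<close>, is the right side; the gap is a completed square.\<close>

lemma mirror_step_stability:
  assumes p: "p \<in> interior_simplex" and q: "q \<in> interior_simplex"
    and x: "\<And>b. - 1 < sqrt (q $ b) * l $ b"
  shows "(q - p) \<bullet> l - root_div p q
    \<le> (\<Sum>b\<in>UNIV. sqrt (q $ b) * (1 / (1 + sqrt (q $ b) * l $ b) - 1 + sqrt (q $ b) * l $ b))"
proof -
  have "(q $ b - p $ b) * l $ b - (sqrt (p $ b) - sqrt (q $ b))\<^sup>2 / sqrt (q $ b)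
    \<le> sqrt (q $ b) * (1 / (1 + sqrt (q $ b) * l $ b) - 1 + sqrt (q $ b) * l $ b)" for b
  proof -
    define r x s where "r = sqrt (q $ b)" and "x = r * l $ b" and "s = sqrt (p $ b)"
    have r: "0 < r" and X: "0 < 1 + x"
      using interior_simplexD(1)[OF q] assms(3)[of b] by (auto simp: r_def x_def)
    have qp: "q $ b = r\<^sup>2" "p $ b = s\<^sup>2" "l $ b = x / r"
      using interior_simplexD(1)[OF q, of b] interior_simplexD(1)[OF p, of b] r
      by (auto simp: r_def s_def x_def)
    have "r * (1 / (1 + x) - 1 + x) - ((r\<^sup>2 - s\<^sup>2) * (x / r) - (s - r)\<^sup>2 / r)
        = (s * (1 + x) - r)\<^sup>2 / (r * (1 + x))"
    proof -
      have "(r * (1 / (1 + x) - 1 + x) - ((r\<^sup>2 - s\<^sup>2) * (x / r) - (s - r)\<^sup>2 / r)) * (r * (1 + x))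
          = r\<^sup>2 * ((1 + x) / (1 + x)) + r\<^sup>2 * (x - 1) * (1 + x)
            - (r / r) * ((r\<^sup>2 - s\<^sup>2) * x - (s - r)\<^sup>2) * (1 + x)"
        by (simp add: field_simps power2_eq_square)
      also have "\<dots> = (s * (1 + x) - r)\<^sup>2"
        using r X by (simp add: algebra_simps power2_eq_square)
      finally show ?thesis using r X by (simp add: eq_divide_eq)
    qed
    also have "\<dots> \<ge> 0" using r X by simp
    finally show ?thesis
      unfolding qp(3) unfolding s_def[symmetric] r_def[symmetric] using r by (simp add: qp)
  qed
  then show ?thesis
    unfolding root_div_def inner_vec_def by (simp add: sum_subtractf[symmetric] sum_mono)
qed

text \<open>Here r^2 is the probability of playing the coordinate, and the two summands are the
  played and unplayed branches. They are at most 2c - c^2/(r + r^2 + c) and cr + c^2/(r + r^2 + c),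
  so the second-order terms cancel.\<close>

lemma coordinate_stability:
  fixes r c \<eta> s :: real
  assumes r: "0 < r" "r \<le> 1" and c: "0 \<le> c" "c \<le> 1 / 2" and \<eta>: "\<eta>\<^sup>2 = 8 * c" and s: "\<bar>s\<bar> \<le> 1 / 2"
  defines "x \<equiv> s * \<eta> / r + c / r\<^sup>2"
  shows "- 1 < x"
    and "r\<^sup>2 * (1 / (1 + x) - 1 + x) + (1 - r\<^sup>2) * (1 / (1 + - (c / (1 + r))) - 1 + - (c / (1 + r)))
      \<le> c * (2 + r)"
proof -
  define y k where "y = s * \<eta> / r" and "k = c / r\<^sup>2"
  have x: "x = y + k" by (simp add: x_def y_def k_def)
  have k: "0 \<le> k" "r\<^sup>2 * k = c" using r c by (auto simp: k_def)
  have s2: "s\<^sup>2 \<le> 1 / 4" using s power_mono[of "\<bar>s\<bar>" "1/2" 2] by (simp add: power2_eq_square)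
  have "y\<^sup>2 = 8 * s\<^sup>2 * k"
    using \<eta> by (simp add: y_def k_def power_mult_distrib power_divide)
  also have "\<dots> \<le> 8 * (1 / 4) * k" using s2 k by (intro mult_right_mono) auto
  finally have y: "y\<^sup>2 \<le> 2 * k" by simp
  \<comment> \<open>Because k is at least y^2/2, the denominator 1 + y + k is at least ((1 + y)^2 +
    1)/2.\<close>
  have "(1 + y)\<^sup>2 + 1 \<le> 2 * (1 + y + k)" using y by (simp add: power2_eq_square algebra_simps)
  then have pos: "0 < 1 + y + k" using zero_le_power2[of "1 + y"] by argo
  then show "- 1 < x" by (simp add: x)
  \<comment> \<open>From \<open>c <= 1/2\<close>: y^2 <= 2c/r^2 <= 1/r^2. This removes the
    sign-dependent \<open>y\<close> from the denominator of the negative term, which must be kept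
    for the cancellation.\<close>
  have "y \<le> 1 / r"
  proof (rule power2_le_imp_le)
    show "y\<^sup>2 \<le> (1 / r)\<^sup>2"
      using y r c by (simp add: k_def power_divide) (smt (verit) divide_right_mono zero_le_power2)
  qed (use r in simp)
  then have "1 / (1 + 1 / r + k) \<le> 1 / (1 + y + k)"
    using pos by (intro divide_left_mono) auto
  then have yr: "k\<^sup>2 * (1 / (1 + 1 / r + k)) \<le> k\<^sup>2 * (1 / (1 + y + k))"
    by (rule mult_left_mono) simp
  have "1 / (1 + x) - 1 + y = (y\<^sup>2 + y * k - k) / (1 + y + k)"
    using pos by (simp add: x field_simps power2_eq_square)
  also have "\<dots> \<le> (k + y * k) / (1 + y + k)"
    using y pos by (intro divide_right_mono) auto
  also have "\<dots> = k - k\<^sup>2 * (1 / (1 + y + k))"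
    using pos by (simp add: field_simps power2_eq_square)
  finally have "1 / (1 + x) - 1 + x \<le> 2 * k - k\<^sup>2 * (1 / (1 + 1 / r + k))"
    using yr by (simp add: x)
  then have "r\<^sup>2 * (1 / (1 + x) - 1 + x) \<le> r\<^sup>2 * (2 * k - k\<^sup>2 * (1 / (1 + 1 / r + k)))"
    by (rule mult_left_mono) simp
  also have "\<dots> = 2 * c - c\<^sup>2 / (r + r\<^sup>2 + c)"
  proof -
    have "r + r\<^sup>2 + c = r\<^sup>2 * (1 + 1 / r + k)"
      using r k(2) by (simp add: algebra_simps power2_eq_square)
    then have "c\<^sup>2 / (r + r\<^sup>2 + c) = (r\<^sup>2 * k)\<^sup>2 / (r\<^sup>2 * (1 + 1 / r + k))"
      using k(2) by simp
    also have "\<dots> = r\<^sup>2 * k\<^sup>2 / (1 + 1 / r + k)"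
      using r by (simp add: power2_eq_square)
    finally show ?thesis using k(2) by (simp add: right_diff_distrib)
  qed
  finally have A: "r\<^sup>2 * (1 / (1 + x) - 1 + x) \<le> 2 * c - c\<^sup>2 / (r + r\<^sup>2 + c)" .
  have p: "0 < 1 + r - c" "0 < r + r\<^sup>2 + c" using r c by (auto intro!: add_pos_nonneg)
  have B: "(1 - r\<^sup>2) * (1 / (1 + - (c / (1 + r))) - 1 + - (c / (1 + r)))
      = c * ((c - (r + r\<^sup>2)) / (1 + r - c) + r)"
  proof -
    have "1 / (1 + - (c / (1 + r))) = (1 + r) / (1 + r - c)"
      using p r by (simp add: field_simps)
    moreover have "(1 + r) / (1 + r - c) - 1 = c / (1 + r - c)"
      using p by (simp add: field_simps)
    moreover have "(1 - r\<^sup>2) * (c / (1 + r)) = c * (1 - r)"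
      using r by (simp add: field_simps power2_eq_square)
    moreover have "(1 - r\<^sup>2) * (c / (1 + r - c)) = c * ((c - (r + r\<^sup>2)) / (1 + r - c) + 1)"
      using p by (simp add: field_simps)
    ultimately show ?thesis
      by (simp add: algebra_simps)
  qed
  \<comment> \<open>Cross-multiplied with t = r + r^2, this is c^2 - t^2 <= c(1 + r - c); again
    \<open>c <= 1/2\<close> suffices.\<close>
  have "(c - (r + r\<^sup>2)) / (1 + r - c) \<le> c / (r + r\<^sup>2 + c)"
  proof -
    have "(c - (r + r\<^sup>2)) * (r + r\<^sup>2 + c) = c\<^sup>2 - (r + r\<^sup>2)\<^sup>2" by algebra
    also have "\<dots> \<le> c * c" by (simp add: power2_eq_square)
    also have "\<dots> \<le> c * (1 + r - c)" using c r by (intro mult_left_mono) auto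
    finally show ?thesis using p by (simp add: pos_divide_le_eq pos_le_divide_eq)
  qed
  then have "c * ((c - (r + r\<^sup>2)) / (1 + r - c) + r) \<le> c * (c / (r + r\<^sup>2 + c) + r)"
    using c by (intro mult_left_mono) auto
  also have "\<dots> = c\<^sup>2 / (r + r\<^sup>2 + c) + c * r" by (simp add: power2_eq_square algebra_simps)
  finally show "r\<^sup>2 * (1 / (1 + x) - 1 + x) + (1 - r\<^sup>2) * (1 / (1 + - (c / (1 + r))) - 1 + - (c / (1 + r)))
      \<le> c * (2 + r)"
    unfolding B using A by (simp add: algebra_simps)
qed

text \<open>The importance-weighted estimator is unbiased up to a constant vector, which is orthogonal to
  differences of points of the simplex.\<close>

lemma estimator_mean:
  assumes q: "q \<in> interior_simplex"
  shows "(\<Sum>a\<in>UNIV. q $ a * (((1 / q $ a) *\<^sub>R estimator \<eta> q a (z a)) $ b)) = z b - 1 / 2 + \<eta> / 8"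
proof -
  define e where "e = 1 / (q $ b + sqrt (q $ b))"
  have "(\<Sum>a\<in>UNIV. q $ a * (((1 / q $ a) *\<^sub>R estimator \<eta> q a (z a)) $ b))
      = (\<Sum>a\<in>UNIV. (if a = b then z b - 1 / 2 + \<eta> / 8 * (1 + e) else 0) - q $ a * (\<eta> / 8 * e))"
    using interior_simplexD(1)[OF q]
    by (intro sum.cong) (auto simp: estimator_def e_def less_imp_neq[symmetric])
  also have "\<dots> = z b - 1 / 2 + \<eta> / 8 * (1 + e) - (\<Sum>a\<in>UNIV. q $ a) * (\<eta> / 8 * e)"
    by (simp add: sum_subtractf sum_distrib_right)
  also have "\<dots> = z b - 1 / 2 + \<eta> / 8"
    by (simp add: interior_simplexD(2)[OF q] algebra_simps)
  finally show ?thesis .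
qed

text \<open>With r the root of q_b, the played coordinate simplifies by (1 - r^2)/(r^2 + r) = 1/r -
  1, which collapses the correction to a multiple of 1/r. In the others the factor
  \<open>q $ a\<close> cancels the importance weight.\<close>

lemma estimator_scaled:
  assumes q: "q \<in> interior_simplex" and \<eta>: "\<eta>\<^sup>2 = 8 * c"
  shows "sqrt (q $ b) * (\<eta> *\<^sub>R ((1 / q $ a) *\<^sub>R estimator \<eta> q a \<sigma>)) $ b =
    (if a = b then (\<sigma> - 1 / 2) * \<eta> / sqrt (q $ b) + c / (sqrt (q $ b))\<^sup>2 else - (c / (1 + sqrt (q $ b))))"
proof -
  define r where "r = sqrt (q $ b)"
  have r: "0 < r" "q $ b = r\<^sup>2" using interior_simplexD(1)[OF q, of b] by (auto simp: r_def)
  have qa: "q $ a \<noteq> 0" using interior_simplexD(1)[OF q, of a] by simp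
  have c: "c = \<eta>\<^sup>2 / 8" using \<eta> by simp
  have e: "1 / (r\<^sup>2 + r) = 1 / (r * (1 + r))" by (simp add: power2_eq_square algebra_simps)
  have r1: "1 + r \<noteq> 0" using r by simp
  show ?thesis
  proof (cases "a = b")
    case True
    have "\<eta> / 8 * (1 + 1 / (r\<^sup>2 + r)) - r\<^sup>2 * \<eta> / 8 * (1 / (r\<^sup>2 + r)) = \<eta> / (8 * r)"
    proof -
      have "(1 - r\<^sup>2) * (1 / (r\<^sup>2 + r)) = ((1 - r) * (1 + r)) / (r * (1 + r))"
        unfolding e by (simp add: power2_eq_square algebra_simps)
      also have "\<dots> = 1 / r - 1" using r r1 by (simp add: diff_divide_distrib)
      finally have "\<eta> / 8 * (1 + (1 - r\<^sup>2) * (1 / (r\<^sup>2 + r))) = \<eta> / (8 * r)" by simp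
      then show ?thesis by (simp add: algebra_simps diff_divide_distrib)
    qed
    then have est: "estimator \<eta> q b \<sigma> $ b = \<sigma> - 1 / 2 + \<eta> / (8 * r)"
      using True r(2) by (simp add: estimator_def r_def[symmetric] abs_of_pos[OF r(1)])
    have "r * (\<eta> * ((\<sigma> - 1 / 2 + \<eta> / (8 * r)) / r\<^sup>2)) = (\<sigma> - 1 / 2) * \<eta> / r + \<eta>\<^sup>2 / 8 / r\<^sup>2"
      using r(1) by (simp add: field_simps power2_eq_square)
    then show ?thesis
      unfolding c True by (simp add: est r(2) r_def[symmetric] abs_of_pos[OF r(1)])
  next
    case False
    then have "estimator \<eta> q a \<sigma> $ b = - (q $ a * \<eta> / 8 * (1 / (r * (1 + r))))"
      unfolding e[symmetric] using r(2)
      by (simp add: estimator_def r_def[symmetric] abs_of_pos[OF r(1)])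
    then show ?thesis
      using False r r1 qa unfolding c
      by (simp add: r_def[symmetric] power2_eq_square)
  qed
qed

text \<open>The divergence to the comparator vertex acts as a Lyapunov function: its expected drop
  pays for the scaled regret of the round, up to the stability cost. The sum over \<open>a\<close>
  is the expectation over an action drawn from \<open>q\<close>.\<close>

lemma md_round:
  fixes q z :: "real^'d::finite"
  assumes q: "q \<in> interior_simplex" and "0 < \<eta>" and \<eta>: "\<eta>\<^sup>2 = 8 * c" and c: "c \<le> 1 / 2"
    and z: "\<And>a. z $ a \<in> {0..1}"
  shows "(\<Sum>a\<in>UNIV. q $ a * (\<eta> * (z $ a - z $ i) + root_div (axis i 1) (md_step \<eta> q a (z $ a))))
    \<le> root_div (axis i 1) q + c * (2 * sqrt (real CARD('d)) + 1)"
proof -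
  let ?e = "axis i 1 :: real^'d"
  define l where "l = (\<lambda>a. (1 / q $ a) *\<^sub>R estimator \<eta> q a (z $ a))"
  define p where "p = (\<lambda>a. md_step \<eta> q a (z $ a))"
  define x where "x = (\<lambda>a b. sqrt (q $ b) * (\<eta> *\<^sub>R l a) $ b)"
  define f where "f = (\<lambda>x::real. 1 / (1 + x) - 1 + x)"
  have c0: "0 \<le> c" using \<eta> zero_le_power2[of \<eta>] by simp
  note qpos = interior_simplexD(1)[OF q] and qsum = interior_simplexD(2)[OF q]
  have x: "x a b = (if a = b then (z $ a - 1 / 2) * \<eta> / sqrt (q $ b) + c / (sqrt (q $ b))\<^sup>2
      else - (c / (1 + sqrt (q $ b))))" for a b
    unfolding x_def l_def by (rule estimator_scaled[OF q \<eta>])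
  have r: "0 < sqrt (q $ b)" "sqrt (q $ b) \<le> 1" for b
    using q interior_simplex_subset qpos by (auto simp: prob_simplex_def)
  have s: "\<bar>z $ b - 1 / 2\<bar> \<le> 1 / 2" for b using z[of b] unfolding abs_le_iff by auto
  note coord = coordinate_stability[OF r c0 c \<eta> s]
  have x1: "- 1 < x a b" for a b
  proof -
    have "c / (1 + sqrt (q $ b)) < 1" using r(1)[of b] c by (subst divide_less_eq_1_pos) linarith+
    then show ?thesis using coord(1) by (auto simp: x)
  qed
  \<comment> \<open>Split \<open>q - ?e\<close> at \<open>p a\<close>: the three-point equation
    handles \<open>p a - ?e\<close>, and \<open>mirror_step_stability\<close> handles
    \<open>q - p a\<close>.\<close>
  have step: "root_div ?e (p a) \<le> root_div ?e q - \<eta> * ((q - ?e) \<bullet> l a) + (\<Sum>b\<in>UNIV. sqrt (q $ b) * f (x a b))"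
    for a
  proof -
    have pa: "p a \<in> interior_simplex"
      unfolding p_def by (rule md_step_interior[OF q \<open>0 < \<eta>\<close>])
    have "\<eta> * ((p a - ?e) \<bullet> l a) = root_div ?e q - root_div ?e (p a) - root_div (p a) q"
      unfolding p_def md_step_def Let_def l_def
      by (rule mirror_step(2)[OF q \<open>0 < \<eta>\<close> axis_in_prob_simplex])
    moreover have "(q - p a) \<bullet> (\<eta> *\<^sub>R l a) - root_div (p a) q \<le> (\<Sum>b\<in>UNIV. sqrt (q $ b) * f (x a b))"
      unfolding f_def x_def
      by (rule mirror_step_stability[OF pa q]) (use x1 in \<open>simp only: x_def\<close>)
    ultimately show ?thesis
      by (simp add: inner_diff_left algebra_simps)
  qed
  have mean: "(\<Sum>a\<in>UNIV. q $ a * ((q - ?e) \<bullet> l a)) = (\<Sum>a\<in>UNIV. q $ a * (z $ a - z $ i))"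
  proof -
    have "(\<Sum>a\<in>UNIV. q $ a * ((q - ?e) \<bullet> l a)) = (\<Sum>b\<in>UNIV. (q - ?e) $ b * (\<Sum>a\<in>UNIV. q $ a * l a $ b))"
      unfolding inner_vec_def sum_distrib_left
      by (subst sum.swap) (simp add: mult.left_commute)
    also have "\<dots> = (\<Sum>b\<in>UNIV. (q - ?e) $ b * (z $ b - 1 / 2 + \<eta> / 8))"
      unfolding l_def estimator_mean[OF q] ..
    also have "\<dots> = (\<Sum>b\<in>UNIV. (q - ?e) $ b * z $ b) + (\<Sum>b\<in>UNIV. (q - ?e) $ b) * (\<eta> / 8 - 1 / 2)"
      unfolding sum_distrib_right sum.distrib[symmetric] by (simp add: algebra_simps)
    also have "(\<Sum>b\<in>UNIV. (q - ?e) $ b) = 0"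
      using axis_in_prob_simplex[of i] qsum by (simp add: sum_subtractf prob_simplex_def)
    also have "(\<Sum>b\<in>UNIV. (q - ?e) $ b * z $ b) = (\<Sum>b\<in>UNIV. q $ b * z $ b) - z $ i"
      using cart_eq_inner_axis[of z i]
      by (simp add: right_diff_distrib sum_subtractf inner_vec_def mult.commute)
    also have "\<dots> = (\<Sum>a\<in>UNIV. q $ a * (z $ a - z $ i))"
      using qsum by (simp add: right_diff_distrib sum_subtractf sum_distrib_right[symmetric])
    finally show ?thesis by simp
  qed
  have stab: "(\<Sum>a\<in>UNIV. q $ a * (\<Sum>b\<in>UNIV. sqrt (q $ b) * f (x a b))) \<le> c * (2 * sqrt (real CARD('d)) + 1)"
  proof -
    have "(\<Sum>a\<in>UNIV. q $ a * (\<Sum>b\<in>UNIV. sqrt (q $ b) * f (x a b)))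
        = (\<Sum>b\<in>UNIV. sqrt (q $ b) * (\<Sum>a\<in>UNIV. q $ a * f (x a b)))"
      unfolding sum_distrib_left by (subst sum.swap) (simp add: mult.left_commute)
    also have "\<dots> \<le> (\<Sum>b\<in>UNIV. sqrt (q $ b) * (c * (2 + sqrt (q $ b))))"
    proof (intro sum_mono mult_left_mono)
      fix b
      \<comment> \<open>For \<open>a\<close> other than \<open>b\<close> the value
        \<open>x a b\<close> does not depend on \<open>a\<close>, so these actions merge into one
        branch of weight \<open>1 - q $ b\<close>, as \<open>coordinate_stability\<close>
        expects.\<close>
      have "(\<Sum>a\<in>UNIV. q $ a * f (x a b))
          = q $ b * f (x b b) + (\<Sum>a\<in>UNIV - {b}. q $ a * f (- (c / (1 + sqrt (q $ b)))))"
        by (subst sum.remove[of _ b]) (auto simp: x)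
      also have "(\<Sum>a\<in>UNIV - {b}. q $ a * f (- (c / (1 + sqrt (q $ b)))))
          = (1 - q $ b) * f (- (c / (1 + sqrt (q $ b))))"
        using qsum by (simp add: sum_distrib_right[symmetric] sum_diff1)
      also have "q $ b * f (x b b) + \<dots> \<le> c * (2 + sqrt (q $ b))"
        using coord(2)[of b b] qpos[of b] by (simp add: f_def x less_imp_le)
      finally show "(\<Sum>a\<in>UNIV. q $ a * f (x a b)) \<le> c * (2 + sqrt (q $ b))" .
    qed (use r in \<open>simp add: less_imp_le\<close>)
    also have "\<dots> = c * (2 * (\<Sum>b\<in>UNIV. sqrt (q $ b)) + (\<Sum>b\<in>UNIV. q $ b))"
      using qpos by (simp add: sum_distrib_left sum.distrib[symmetric] less_imp_le algebra_simps)
    also have "\<dots> \<le> c * (2 * sqrt (real CARD('d)) + 1)"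
      using sum_sqrt_le[of q] q interior_simplex_subset qsum c0 by (intro mult_left_mono) auto
    finally show ?thesis .
  qed
  have "(\<Sum>a\<in>UNIV. q $ a * (\<eta> * (z $ a - z $ i) + root_div ?e (p a)))
      \<le> (\<Sum>a\<in>UNIV. q $ a * (\<eta> * (z $ a - z $ i) +
            (root_div ?e q - \<eta> * ((q - ?e) \<bullet> l a) + (\<Sum>b\<in>UNIV. sqrt (q $ b) * f (x a b)))))"
    using qpos by (intro sum_mono mult_left_mono add_left_mono step) (auto simp: less_imp_le)
  also have "\<dots> = \<eta> * (\<Sum>a\<in>UNIV. q $ a * (z $ a - z $ i)) + (\<Sum>a\<in>UNIV. q $ a) * root_div ?e q
      - \<eta> * (\<Sum>a\<in>UNIV. q $ a * ((q - ?e) \<bullet> l a))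
      + (\<Sum>a\<in>UNIV. q $ a * (\<Sum>b\<in>UNIV. sqrt (q $ b) * f (x a b)))"
    unfolding sum_distrib_left[of \<eta>] sum_distrib_right[of _ _ "root_div ?e q"]
      sum.distrib[symmetric] sum_subtractf[symmetric]
    by (intro sum.cong) (simp_all only: algebra_simps)
  also have "\<dots> \<le> root_div ?e q + c * (2 * sqrt (real CARD('d)) + 1)"
    unfolding mean using stab qsum by simp
  finally show ?thesis by (simp add: p_def)
qed

section \<open>Expectations along the interaction\<close>

lemma length_interaction: "h \<in> set_pmf (interaction \<pi> z t) \<Longrightarrow> length h = t"
  by (induction t arbitrary: h) auto

text \<open>Finite support makes every real function of the history integrable.\<close>

lemma finite_interaction: "finite (set_pmf (interaction \<pi> z t))"
  by (induction t) auto

lemma expectation_interaction_Suc: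
  fixes G :: "('d::finite) history \<Rightarrow> real"
  shows "measure_pmf.expectation (interaction \<pi> z (Suc t)) G =
    measure_pmf.expectation (interaction \<pi> z t) (\<lambda>h. \<Sum>a\<in>UNIV. pmf (\<pi> h) a * G (h @ [(a, z (Suc t) $ a)]))"
proof -
  let ?S = "set_pmf (interaction \<pi> z t)"
  have "measure_pmf.expectation (map_pmf (\<lambda>a. h @ [(a, z (Suc t) $ a)]) (\<pi> h)) G
      = (\<Sum>a\<in>UNIV. pmf (\<pi> h) a * G (h @ [(a, z (Suc t) $ a)]))" for h
    by (simp add: integral_measure_pmf_real[of UNIV] mult.commute)
  then show ?thesis
    by (simp add: pmf_expectation_bind[OF finite_interaction _ order_refl]
        integral_measure_pmf_real[OF finite_interaction] mult.commute)
qed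

lemma action_snoc_less: "1 \<le> s \<Longrightarrow> s \<le> length h \<Longrightarrow> action (h @ [x]) s = action h s"
  by (auto simp: action_def nth_append)

lemma action_snoc_last: "action (h @ [x]) (Suc (length h)) = fst x"
  by (simp add: action_def)

text \<open>Keeping the current divergence inside the expectation lets \<open>md_round\<close> be
  applied conditionally on each history, so the bounds telescope by induction.\<close>

lemma md_potential_bound:
  fixes z :: "nat \<Rightarrow> real^'d::finite"
  assumes "0 < \<eta>" and \<eta>: "\<eta>\<^sup>2 = 8 * c" and c: "c \<le> 1 / 2"
    and z: "\<And>s a. s \<in> {1..t} \<Longrightarrow> z s $ a \<in> {0..1}"
  shows "measure_pmf.expectation (interaction (mirror_descent \<eta>) z t)
      (\<lambda>h. \<eta> * (\<Sum>s=1..t. z s $ action h s - z s $ i) + root_div (axis i 1) (md_iterate \<eta> h))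
    \<le> root_div (axis i 1) (md_start :: real^'d) + real t * (c * (2 * sqrt (real CARD('d)) + 1))"
  using z
proof (induction t)
  case 0
  then show ?case by (simp add: md_iterate_def)
next
  case (Suc t)
  let ?\<pi> = "mirror_descent \<eta> :: 'd learner"
  let ?L = "\<lambda>t h. \<Sum>s=1..t. z s $ action h s - z s $ i"
  let ?D = "root_div (axis i 1) :: real^'d \<Rightarrow> real"
  let ?K = "c * (2 * sqrt (real CARD('d)) + 1)"
  have int: "integrable (measure_pmf (interaction ?\<pi> z t)) G" for G :: "'d history \<Rightarrow> real"
    by (rule integrable_measure_pmf_finite[OF finite_interaction])
  have round: "(\<Sum>a\<in>UNIV. pmf (?\<pi> h) a * (\<eta> * ?L (Suc t) (h @ [(a, z (Suc t) $ a)])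
        + ?D (md_iterate \<eta> (h @ [(a, z (Suc t) $ a)])))) \<le> (\<eta> * ?L t h + ?D (md_iterate \<eta> h)) + ?K"
    if h: "h \<in> set_pmf (interaction ?\<pi> z t)" for h
  proof -
    let ?q = "md_iterate \<eta> h"
    have len: "length h = t" using length_interaction[OF h] .
    have q: "?q \<in> interior_simplex" by (rule md_iterate_interior[OF \<open>0 < \<eta>\<close>])
    have "?L t (h @ [y]) = ?L t h" for y
      using len by (intro sum.cong) (auto simp: action_snoc_less)
    then have L: "?L (Suc t) (h @ [y]) = ?L t h + (z (Suc t) $ fst y - z (Suc t) $ i)" for y
      using action_snoc_last[of h y] len by simp
    have "(\<Sum>a\<in>UNIV. pmf (?\<pi> h) a * (\<eta> * ?L (Suc t) (h @ [(a, z (Suc t) $ a)])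
        + ?D (md_iterate \<eta> (h @ [(a, z (Suc t) $ a)]))))
      = (\<Sum>a\<in>UNIV. ?q $ a * (\<eta> * ?L t h) + ?q $ a * (\<eta> * (z (Suc t) $ a - z (Suc t) $ i)
          + ?D (md_step \<eta> ?q a (z (Suc t) $ a))))"
      unfolding L pmf_mirror_descent[OF \<open>0 < \<eta>\<close>]
      by (simp add: md_iterate_def algebra_simps)
    also have "\<dots> = \<eta> * ?L t h + (\<Sum>a\<in>UNIV. ?q $ a * (\<eta> * (z (Suc t) $ a - z (Suc t) $ i)
          + ?D (md_step \<eta> ?q a (z (Suc t) $ a))))"
      unfolding sum.distrib sum_distrib_right[symmetric] interior_simplexD(2)[OF q] by simp
    also have "\<dots> \<le> \<eta> * ?L t h + (?D ?q + ?K)"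
      using Suc.prems by (intro add_left_mono md_round[OF q \<open>0 < \<eta>\<close> \<eta> c]) auto
    finally show ?thesis by simp
  qed
  have "measure_pmf.expectation (interaction ?\<pi> z (Suc t)) (\<lambda>h. \<eta> * ?L (Suc t) h + ?D (md_iterate \<eta> h))
      \<le> measure_pmf.expectation (interaction ?\<pi> z t) (\<lambda>h. (\<eta> * ?L t h + ?D (md_iterate \<eta> h)) + ?K)"
    unfolding expectation_interaction_Suc
    by (intro integral_mono_AE int) (use round in \<open>simp add: AE_measure_pmf_iff\<close>)
  also have "\<dots> = measure_pmf.expectation (interaction ?\<pi> z t) (\<lambda>h. \<eta> * ?L t h + ?D (md_iterate \<eta> h)) + ?K"
    by (subst Bochner_Integration.integral_add[OF int int]) simp
  also have "\<dots> \<le> (?D md_start + real t * ?K) + ?K"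
    using Suc.prems by (intro add_right_mono Suc.IH) auto
  finally show ?case by (simp add: algebra_simps)
qed

theorem mainTheorem3:
  fixes z :: "nat \<Rightarrow> real^'d::finite" and n :: nat
  assumes "CARD('d) \<ge> 2" and "n \<ge> 1"
    and "\<And>t a. t \<in> {1..n} \<Longrightarrow> z t $ a \<in> {0..1}"
  shows "regret (mirror_descent (sqrt (8 / real n))) z n \<le> sqrt (2 * real CARD('d) * real n)"
proof -
  define \<eta> where "\<eta> = sqrt (8 / real n)"
  let ?M = "interaction (mirror_descent \<eta>) z n"
  let ?L = "\<lambda>i h. \<Sum>t=1..n. z t $ action h t - z t $ i"
  let ?d = "sqrt (real CARD('d))"
  have int: "integrable (measure_pmf ?M) G" for G :: "'d history \<Rightarrow> real"
    by (rule integrable_measure_pmf_finite[OF finite_interaction])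
  have "measure_pmf.expectation ?M (?L i) \<le> sqrt (2 * real CARD('d) * real n)" for i
  proof (cases "n = 1")
    \<comment> \<open>Here c = 1/n would be 1, outside the range of
      \<open>md_potential_bound\<close>; a single round has regret at most 1.\<close>
    case True
    have "measure_pmf.expectation ?M (?L i) \<le> measure_pmf.expectation ?M (\<lambda>_. 1)"
    proof (intro integral_mono int)
      show "?L i h \<le> 1" for h
        using True assms(3)[of 1 "action h 1"] assms(3)[of 1 i] by simp
    qed
    also have "\<dots> \<le> sqrt (2 * real CARD('d) * real n)"
      using True assms(1) by simp
    finally show ?thesis .
  next
    case False
    then have n: "2 \<le> n" using assms(2) by simp
    have \<eta>: "0 < \<eta>" "\<eta>\<^sup>2 = 8 * (1 / real n)" "1 / real n \<le> 1 / 2"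
      using n by (auto simp: \<eta>_def field_simps)
    have "\<eta> * measure_pmf.expectation ?M (?L i) = measure_pmf.expectation ?M (\<lambda>h. \<eta> * ?L i h)"
      by simp
    \<comment> \<open>The final divergence is nonnegative, so it may be added to match the
      telescoped bound.\<close>
    also have "\<dots> \<le> measure_pmf.expectation ?M (\<lambda>h. \<eta> * ?L i h + root_div (axis i 1) (md_iterate \<eta> h))"
      using interior_simplexD(1)[OF md_iterate_interior[OF \<eta>(1)]]
      by (intro integral_mono int) (simp, intro root_div_nonneg less_imp_le)
    also have "\<dots> \<le> root_div (axis i 1) (md_start :: real^'d) + real n * (1 / real n * (2 * ?d + 1))"
      by (rule md_potential_bound[OF \<eta> assms(3)])
    \<comment> \<open>Initial divergence 2 sqrt(d) - 2 plus total stability cost 2 sqrt(d) +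
      1.\<close>
    also have "\<dots> \<le> 4 * ?d - 1"
      using md_start(2)[of i] n by simp
    also have "\<dots> \<le> 4 * ?d" by simp
    also have "\<dots> = \<eta> * sqrt (2 * real CARD('d) * real n)"
    proof -
      have "\<eta> * sqrt (2 * real CARD('d) * real n) = sqrt (16 * real CARD('d))"
        unfolding \<eta>_def real_sqrt_mult[symmetric] using n by simp
      then show ?thesis by (simp add: real_sqrt_mult)
    qed
    finally show ?thesis using \<eta>(1) by simp
  qed
  then show ?thesis
    unfolding regret_def \<eta>_def[symmetric] by (subst Max_le_iff) auto
qed

end
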